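(* Let $\mathcal S=(\Pi,A,\xi)$ and $\mathcal S'=(\Pi',A',\xi')$ be Gr-categories of type $(\Pi,A)$ and $(\Pi',A')$ respectively, and let $(F,\widetilde F)$ be a Gr-functor from $\mathcal S$ to $\mathcal S'$. Then $F$ is a functor of the type $(\varphi,f)$; that is, there exist group homomorphisms $\varphi:\Pi\to\Pi'$ and $f:A\to A'$ with $f(xa)=\varphi(x)f(a)$ for all $x\in\Pi$, $a\in A$, such that $$F(x)=\varphi(x),\qquad F(x,u)=(\varphi(x),f(u))\qquad\text{for all }x\in\Pi,\ u\in A.$$
   Context: A Gr-category is a monoidal category $(\mathcal C,\otimes,I,a,l,r)$ in which every object is invertible (for $\otimes$, up to isomorphism) and every arrow is an isomorphism; the associativity constraint is directed as $a_{X,Y,Z}:X\otimes(Y\otimes Z)\to(X\otimes Y)\otimes Z$. A Gr-functor is a monoidal functor $(F,\widetilde F,\hat F)$ between Gr-categories, with natural isomorphisms $\widetilde F_{X,Y}:FX\otimes FY\to F(X\otimes Y)$ and an isomorphism $\hat F:I'\to FI$ satisfying the usual coherence conditions; it is often denoted just $(F,\widetilde F)$. Given a group $\Pi$, a (left) $\Pi$-module $A$ (written additively) and a normalized 3-cocycle $\xi:\Pi^3\to A$, the Gr-category $(\Pi,A,\xi)$ (of type $(\Pi,A)$) has as objects the elements of $\Pi$ and as arrows the automorphisms $(x,u):x\to x$ with $x\in\Pi$, $u\in A$ (no arrows between distinct objects); composition is $(x,u).(x,v)=(x,u+v)$; the tensor product is $x\otimes y=xy$, $(x,u)\otimes(y,v)=(xy,u+xv)$;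 the unit constraints are identities (with unit object $1$); and the associativity constraint is $a_{x,y,z}=(xyz,\xi(x,y,z))$. *)

theory Defs
  imports "HOL-Algebra.Group" "HOL-Algebra.Ring"
begin

record ('o, 'm) cat =
  Obj :: "'o set"
  Arr :: "'m set"
  Dom :: "'m \<Rightarrow> 'o"
  Cod :: "'m \<Rightarrow> 'o"
  Ident :: "'o \<Rightarrow> 'm"
  Comp :: "'m \<Rightarrow> 'm \<Rightarrow> 'm"  (infixr "\<cdot>\<index>" 75)

text \<open>
  Composition is written in the applicative order: \<open>g \<cdot> f\<close> is ``first \<open>f\<close>, then \<open>g\<close>''.
  Its value on non-composable arguments is irrelevant.
\<close>

definition Hom :: "('o, 'm, 'x) cat_scheme \<Rightarrow> 'o \<Rightarrow> 'o \<Rightarrow> 'm set" where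
  "Hom C x y = {f \<in> Arr C. Dom C f = x \<and> Cod C f = y}"

locale category =
  fixes C :: "('o, 'm, 'x) cat_scheme" (structure)
  assumes Dom_closed: "f \<in> Arr C \<Longrightarrow> Dom C f \<in> Obj C"
    and Cod_closed: "f \<in> Arr C \<Longrightarrow> Cod C f \<in> Obj C"
    and Ident_Hom: "x \<in> Obj C \<Longrightarrow> Ident C x \<in> Hom C x x"
    and Comp_Hom: "\<lbrakk>f \<in> Hom C x y; g \<in> Hom C y z\<rbrakk> \<Longrightarrow> g \<cdot> f \<in> Hom C x z"
    and Comp_Ident_right: "f \<in> Hom C x y \<Longrightarrow> f \<cdot> Ident C x = f"
    and Comp_Ident_left: "f \<in> Hom C x y \<Longrightarrow> Ident C y \<cdot> f = f"
    and Comp_assoc: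
      "\<lbrakk>f \<in> Hom C w x; g \<in> Hom C x y; h \<in> Hom C y z\<rbrakk> \<Longrightarrow> (h \<cdot> g) \<cdot> f = h \<cdot> (g \<cdot> f)"

definition Iso :: "('o, 'm, 'x) cat_scheme \<Rightarrow> 'o \<Rightarrow> 'o \<Rightarrow> 'm set" where
  "Iso C x y = {f \<in> Hom C x y. \<exists>g \<in> Hom C y x.
     Comp C g f = Ident C x \<and> Comp C f g = Ident C y}"

definition isomorphic :: "('o, 'm, 'x) cat_scheme \<Rightarrow> 'o \<Rightarrow> 'o \<Rightarrow> bool" where
  "isomorphic C x y \<longleftrightarrow> Iso C x y \<noteq> {}"

record ('o, 'm) moncat = "('o, 'm) cat" +
  TenO :: "'o \<Rightarrow> 'o \<Rightarrow> 'o"  (infixr "\<boxtimes>\<index>" 80)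
  TenA :: "'m \<Rightarrow> 'm \<Rightarrow> 'm"  (infixr "\<odot>\<index>" 80)
  UnitO :: 'o
  AssocC :: "'o \<Rightarrow> 'o \<Rightarrow> 'o \<Rightarrow> 'm"
  LeftC :: "'o \<Rightarrow> 'm"
  RightC :: "'o \<Rightarrow> 'm"

text \<open>
  Directions of the constraints: \<open>a\<^sub>x\<^sub>,\<^sub>y\<^sub>,\<^sub>z : x \<otimes> (y \<otimes> z) \<rightarrow> (x \<otimes> y) \<otimes> z\<close>,
  \<open>l\<^sub>x : I \<otimes> x \<rightarrow> x\<close> and \<open>r\<^sub>x : x \<otimes> I \<rightarrow> x\<close>.
\<close>

locale monoidal_category = category C
  for C :: "('o, 'm, 'x) moncat_scheme" (structure) +
  assumes TenO_closed: "\<lbrakk>x \<in> Obj C; y \<in> Obj C\<rbrakk> \<Longrightarrow> x \<boxtimes> y \<in> Obj C"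
    and TenA_Hom:
      "\<lbrakk>f \<in> Hom C x x'; g \<in> Hom C y y'\<rbrakk> \<Longrightarrow> f \<odot> g \<in> Hom C (x \<boxtimes> y) (x' \<boxtimes> y')"
    and TenA_Ident:
      "\<lbrakk>x \<in> Obj C; y \<in> Obj C\<rbrakk> \<Longrightarrow> Ident C x \<odot> Ident C y = Ident C (x \<boxtimes> y)"
    and TenA_Comp:
      "\<lbrakk>f \<in> Hom C x x'; f' \<in> Hom C x' x''; g \<in> Hom C y y'; g' \<in> Hom C y' y''\<rbrakk>
        \<Longrightarrow> (f' \<cdot> f) \<odot> (g' \<cdot> g) = (f' \<odot> g') \<cdot> (f \<odot> g)"
    and UnitO_closed: "UnitO C \<in> Obj C"
    and AssocC_Iso:
      "\<lbrakk>x \<in> Obj C; y \<in> Obj C; z \<in> Obj C\<rbrakk>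
        \<Longrightarrow> AssocC C x y z \<in> Iso C (x \<boxtimes> (y \<boxtimes> z)) ((x \<boxtimes> y) \<boxtimes> z)"
    and AssocC_natural:
      "\<lbrakk>f \<in> Hom C x x'; g \<in> Hom C y y'; h \<in> Hom C z z'\<rbrakk>
        \<Longrightarrow> AssocC C x' y' z' \<cdot> (f \<odot> (g \<odot> h)) = ((f \<odot> g) \<odot> h) \<cdot> AssocC C x y z"
    and LeftC_Iso: "x \<in> Obj C \<Longrightarrow> LeftC C x \<in> Iso C (UnitO C \<boxtimes> x) x"
    and LeftC_natural:
      "f \<in> Hom C x x' \<Longrightarrow> LeftC C x' \<cdot> (Ident C (UnitO C) \<odot> f) = f \<cdot> LeftC C x"
    and RightC_Iso: "x \<in> Obj C \<Longrightarrow> RightC C x \<in> Iso C (x \<boxtimes> UnitO C) x"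
    and RightC_natural:
      "f \<in> Hom C x x' \<Longrightarrow> RightC C x' \<cdot> (f \<odot> Ident C (UnitO C)) = f \<cdot> RightC C x"
    and pentagon:
      "\<lbrakk>w \<in> Obj C; x \<in> Obj C; y \<in> Obj C; z \<in> Obj C\<rbrakk>
        \<Longrightarrow> AssocC C (w \<boxtimes> x) y z \<cdot> AssocC C w x (y \<boxtimes> z)
          = (AssocC C w x y \<odot> Ident C z) \<cdot> AssocC C w (x \<boxtimes> y) z \<cdot> (Ident C w \<odot> AssocC C x y z)"
    and triangle:
      "\<lbrakk>x \<in> Obj C; y \<in> Obj C\<rbrakk>
        \<Longrightarrow> (RightC C x \<odot> Ident C y) \<cdot> AssocC C x (UnitO C) y = Ident C x \<odot> LeftC C y"

locale gr_category = monoidal_category C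
  for C :: "('o, 'm, 'x) moncat_scheme" (structure) +
  assumes Arr_Iso: "f \<in> Arr C \<Longrightarrow> f \<in> Iso C (Dom C f) (Cod C f)"
    and Obj_invertible:
      "x \<in> Obj C \<Longrightarrow>
        \<exists>y \<in> Obj C. isomorphic C (x \<boxtimes> y) (UnitO C) \<and> isomorphic C (y \<boxtimes> x) (UnitO C)"

text \<open>
  A functor is given by its object map \<open>Fo\<close> and its arrow map \<open>Fa\<close>; a monoidal functor
  has in addition the components \<open>Ft x y : F x \<otimes> F y \<rightarrow> F (x \<otimes> y)\<close> and \<open>Fu : I' \<rightarrow> F I\<close>.
\<close>

locale category_functor = dom: category C + cod: category D
  for C :: "('o, 'm, 'x) cat_scheme" and D :: "('p, 'n, 'y) cat_scheme" +
  fixes Fo :: "'o \<Rightarrow> 'p" and Fa :: "'m \<Rightarrow> 'n"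
  assumes Fo_closed: "x \<in> Obj C \<Longrightarrow> Fo x \<in> Obj D"
    and Fa_Hom: "f \<in> Hom C x y \<Longrightarrow> Fa f \<in> Hom D (Fo x) (Fo y)"
    and Fa_Ident: "x \<in> Obj C \<Longrightarrow> Fa (Ident C x) = Ident D (Fo x)"
    and Fa_Comp:
      "\<lbrakk>f \<in> Hom C x y; g \<in> Hom C y z\<rbrakk> \<Longrightarrow> Fa (g \<cdot>\<^bsub>C\<^esub> f) = Fa g \<cdot>\<^bsub>D\<^esub> Fa f"

locale monoidal_functor =
  dom: monoidal_category C + cod: monoidal_category D + category_functor C D Fo Fa
  for C :: "('o, 'm, 'x) moncat_scheme" and D :: "('p, 'n, 'y) moncat_scheme"
    and Fo :: "'o \<Rightarrow> 'p" and Fa :: "'m \<Rightarrow> 'n" +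
  fixes Ft :: "'o \<Rightarrow> 'o \<Rightarrow> 'n" and Fu :: 'n
  assumes Ft_Iso:
      "\<lbrakk>x \<in> Obj C; y \<in> Obj C\<rbrakk> \<Longrightarrow> Ft x y \<in> Iso D (Fo x \<boxtimes>\<^bsub>D\<^esub> Fo y) (Fo (x \<boxtimes>\<^bsub>C\<^esub> y))"
    and Ft_natural:
      "\<lbrakk>f \<in> Hom C x x'; g \<in> Hom C y y'\<rbrakk>
        \<Longrightarrow> Ft x' y' \<cdot>\<^bsub>D\<^esub> (Fa f \<odot>\<^bsub>D\<^esub> Fa g) = Fa (f \<odot>\<^bsub>C\<^esub> g) \<cdot>\<^bsub>D\<^esub> Ft x y"
    and Fu_Iso: "Fu \<in> Iso D (UnitO D) (Fo (UnitO C))"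
    and Ft_assoc:
      "\<lbrakk>x \<in> Obj C; y \<in> Obj C; z \<in> Obj C\<rbrakk>
        \<Longrightarrow> Fa (AssocC C x y z) \<cdot>\<^bsub>D\<^esub> Ft x (y \<boxtimes>\<^bsub>C\<^esub> z) \<cdot>\<^bsub>D\<^esub> (Ident D (Fo x) \<odot>\<^bsub>D\<^esub> Ft y z)
          = Ft (x \<boxtimes>\<^bsub>C\<^esub> y) z \<cdot>\<^bsub>D\<^esub> (Ft x y \<odot>\<^bsub>D\<^esub> Ident D (Fo z)) \<cdot>\<^bsub>D\<^esub> AssocC D (Fo x) (Fo y) (Fo z)"
    and Ft_left:
      "x \<in> Obj C
        \<Longrightarrow> Fa (LeftC C x) \<cdot>\<^bsub>D\<^esub> Ft (UnitO C) x \<cdot>\<^bsub>D\<^esub> (Fu \<odot>\<^bsub>D\<^esub> Ident D (Fo x)) = LeftC D (Fo x)"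
    and Ft_right:
      "x \<in> Obj C
        \<Longrightarrow> Fa (RightC C x) \<cdot>\<^bsub>D\<^esub> Ft x (UnitO C) \<cdot>\<^bsub>D\<^esub> (Ident D (Fo x) \<odot>\<^bsub>D\<^esub> Fu) = RightC D (Fo x)"

locale gr_functor =
  dom: gr_category C + cod: gr_category D + monoidal_functor C D Fo Fa Ft Fu
  for C :: "('o, 'm, 'x) moncat_scheme" and D :: "('p, 'n, 'y) moncat_scheme"
    and Fo :: "'o \<Rightarrow> 'p" and Fa :: "'m \<Rightarrow> 'n" and Ft :: "'o \<Rightarrow> 'o \<Rightarrow> 'n" and Fu :: 'n

text \<open>
  The module is the additive group of \<open>A\<close>; the multiplicative fields of the ring record
  are not constrained and never used.
\<close>

locale group_module = grp: group P + ab: abelian_group A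
  for P :: "('g, 'x) monoid_scheme" and A :: "('a, 'y) ring_scheme" +
  fixes act :: "'g \<Rightarrow> 'a \<Rightarrow> 'a"
  assumes act_closed: "\<lbrakk>x \<in> carrier P; a \<in> carrier A\<rbrakk> \<Longrightarrow> act x a \<in> carrier A"
    and act_one: "a \<in> carrier A \<Longrightarrow> act \<one>\<^bsub>P\<^esub> a = a"
    and act_mult:
      "\<lbrakk>x \<in> carrier P; y \<in> carrier P; a \<in> carrier A\<rbrakk> \<Longrightarrow> act (x \<otimes>\<^bsub>P\<^esub> y) a = act x (act y a)"
    and act_add:
      "\<lbrakk>x \<in> carrier P; a \<in> carrier A; b \<in> carrier A\<rbrakk>
        \<Longrightarrow> act x (a \<oplus>\<^bsub>A\<^esub> b) = act x a \<oplus>\<^bsub>A\<^esub> act x b"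

locale normalized_3cocycle = group_module P A act
  for P :: "('g, 'x) monoid_scheme" and A :: "('a, 'y) ring_scheme"
    and act :: "'g \<Rightarrow> 'a \<Rightarrow> 'a" +
  fixes \<xi> :: "'g \<Rightarrow> 'g \<Rightarrow> 'g \<Rightarrow> 'a"
  assumes \<xi>_closed:
      "\<lbrakk>x \<in> carrier P; y \<in> carrier P; z \<in> carrier P\<rbrakk> \<Longrightarrow> \<xi> x y z \<in> carrier A"
    and \<xi>_cocycle:
      "\<lbrakk>x \<in> carrier P; y \<in> carrier P; z \<in> carrier P; t \<in> carrier P\<rbrakk>
        \<Longrightarrow> act x (\<xi> y z t) \<ominus>\<^bsub>A\<^esub> \<xi> (x \<otimes>\<^bsub>P\<^esub> y) z t \<oplus>\<^bsub>A\<^esub> \<xi> x (y \<otimes>\<^bsub>P\<^esub> z) t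
            \<ominus>\<^bsub>A\<^esub> \<xi> x y (z \<otimes>\<^bsub>P\<^esub> t) \<oplus>\<^bsub>A\<^esub> \<xi> x y z = \<zero>\<^bsub>A\<^esub>"
    and \<xi>_normalized:
      "\<lbrakk>x \<in> carrier P; y \<in> carrier P\<rbrakk> \<Longrightarrow> \<xi> \<one>\<^bsub>P\<^esub> x y = \<zero>\<^bsub>A\<^esub>"
      "\<lbrakk>x \<in> carrier P; y \<in> carrier P\<rbrakk> \<Longrightarrow> \<xi> x \<one>\<^bsub>P\<^esub> y = \<zero>\<^bsub>A\<^esub>"
      "\<lbrakk>x \<in> carrier P; y \<in> carrier P\<rbrakk> \<Longrightarrow> \<xi> x y \<one>\<^bsub>P\<^esub> = \<zero>\<^bsub>A\<^esub>"

definition gr_type ::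
  "('g, 'x) monoid_scheme \<Rightarrow> ('a, 'y) ring_scheme \<Rightarrow> ('g \<Rightarrow> 'a \<Rightarrow> 'a) \<Rightarrow>
   ('g \<Rightarrow> 'g \<Rightarrow> 'g \<Rightarrow> 'a) \<Rightarrow> ('g, 'g \<times> 'a) moncat" where
  "gr_type P A act \<xi> =
    \<lparr> Obj = carrier P,
      Arr = carrier P \<times> carrier A,
      Dom = fst,
      Cod = fst,
      Ident = (\<lambda>x. (x, \<zero>\<^bsub>A\<^esub>)),
      Comp = (\<lambda>(x, u) (y, v). (x, u \<oplus>\<^bsub>A\<^esub> v)),
      TenO = (\<lambda>x y. x \<otimes>\<^bsub>P\<^esub> y),
      TenA = (\<lambda>(x, u) (y, v). (x \<otimes>\<^bsub>P\<^esub> y, u \<oplus>\<^bsub>A\<^esub> act x v)),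
      UnitO = \<one>\<^bsub>P\<^esub>,
      AssocC = (\<lambda>x y z. (x \<otimes>\<^bsub>P\<^esub> y \<otimes>\<^bsub>P\<^esub> z, \<xi> x y z)),
      LeftC = (\<lambda>x. (x, \<zero>\<^bsub>A\<^esub>)),
      RightC = (\<lambda>x. (x, \<zero>\<^bsub>A\<^esub>)) \<rparr>"

lemma gr_type_sel:
  "Obj (gr_type P A act \<xi>) = carrier P"
  "Arr (gr_type P A act \<xi>) = carrier P \<times> carrier A"
  "Dom (gr_type P A act \<xi>) = fst"
  "Cod (gr_type P A act \<xi>) = fst"
  "Ident (gr_type P A act \<xi>) x = (x, \<zero>\<^bsub>A\<^esub>)"
  "Comp (gr_type P A act \<xi>) (x, u) (y, v) = (x, u \<oplus>\<^bsub>A\<^esub> v)"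
  "TenO (gr_type P A act \<xi>) x y = x \<otimes>\<^bsub>P\<^esub> y"
  "TenA (gr_type P A act \<xi>) (x, u) (y, v) = (x \<otimes>\<^bsub>P\<^esub> y, u \<oplus>\<^bsub>A\<^esub> act x v)"
  "UnitO (gr_type P A act \<xi>) = \<one>\<^bsub>P\<^esub>"
  "AssocC (gr_type P A act \<xi>) x y z = (x \<otimes>\<^bsub>P\<^esub> y \<otimes>\<^bsub>P\<^esub> z, \<xi> x y z)"
  "LeftC (gr_type P A act \<xi>) x = (x, \<zero>\<^bsub>A\<^esub>)"
  "RightC (gr_type P A act \<xi>) x = (x, \<zero>\<^bsub>A\<^esub>)"
  by (simp_all add: gr_type_def)

context group_module
begin

lemma act_zero: assumes "x \<in> carrier P" shows "act x \<zero>\<^bsub>A\<^esub> = \<zero>\<^bsub>A\<^esub>"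
proof -
  have "act x \<zero>\<^bsub>A\<^esub> \<oplus>\<^bsub>A\<^esub> act x \<zero>\<^bsub>A\<^esub> = act x \<zero>\<^bsub>A\<^esub>"
    using act_add[OF assms, of "\<zero>\<^bsub>A\<^esub>" "\<zero>\<^bsub>A\<^esub>"] by simp
  then show ?thesis
    using act_closed[OF assms ab.zero_closed] ab.add.l_cancel_one' ab.add.l_cancel_one by metis
qed

end

context normalized_3cocycle
begin

lemma \<xi>_pentagon:
  assumes "x \<in> carrier P" "y \<in> carrier P" "z \<in> carrier P" "t \<in> carrier P"
  shows "\<xi> (x \<otimes>\<^bsub>P\<^esub> y) z t \<oplus>\<^bsub>A\<^esub> \<xi> x y (z \<otimes>\<^bsub>P\<^esub> t)
    = \<xi> x y z \<oplus>\<^bsub>A\<^esub> (\<xi> x (y \<otimes>\<^bsub>P\<^esub> z) t \<oplus>\<^bsub>A\<^esub> act x (\<xi> y z t))"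
proof -
  define a b c d e where abs: "a = act x (\<xi> y z t)" "b = \<xi> (x \<otimes>\<^bsub>P\<^esub> y) z t"
    "c = \<xi> x (y \<otimes>\<^bsub>P\<^esub> z) t" "d = \<xi> x y (z \<otimes>\<^bsub>P\<^esub> t)" "e = \<xi> x y z"
  have cl: "a \<in> carrier A" "b \<in> carrier A" "c \<in> carrier A" "d \<in> carrier A" "e \<in> carrier A"
    using assms by (auto simp: abs act_closed \<xi>_closed)
  have "a \<ominus>\<^bsub>A\<^esub> b \<oplus>\<^bsub>A\<^esub> c \<ominus>\<^bsub>A\<^esub> d \<oplus>\<^bsub>A\<^esub> e = \<zero>\<^bsub>A\<^esub>"
    using \<xi>_cocycle[OF assms] by (simp add: abs)
  then have "b \<oplus>\<^bsub>A\<^esub> d = (b \<oplus>\<^bsub>A\<^esub> d) \<oplus>\<^bsub>A\<^esub> (a \<ominus>\<^bsub>A\<^esub> b \<oplus>\<^bsub>A\<^esub> c \<ominus>\<^bsub>A\<^esub> d \<oplus>\<^bsub>A\<^esub> e)"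
    using cl by simp
  also have "\<dots> = (b \<oplus>\<^bsub>A\<^esub> \<ominus>\<^bsub>A\<^esub> b) \<oplus>\<^bsub>A\<^esub> ((d \<oplus>\<^bsub>A\<^esub> \<ominus>\<^bsub>A\<^esub> d) \<oplus>\<^bsub>A\<^esub> (e \<oplus>\<^bsub>A\<^esub> (c \<oplus>\<^bsub>A\<^esub> a)))"
    using cl by (simp add: ab.minus_eq ab.a_ac)
  also have "\<dots> = e \<oplus>\<^bsub>A\<^esub> (c \<oplus>\<^bsub>A\<^esub> a)"
    using cl by (simp add: ab.r_neg)
  finally show ?thesis by (simp add: abs)
qed

lemma Hom_gr_type:
  "Hom (gr_type P A act \<xi>) x y = (if x = y \<and> x \<in> carrier P then {x} \<times> carrier A else {})"
  by (auto simp: Hom_def gr_type_sel)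

lemma Iso_gr_type: "Iso (gr_type P A act \<xi>) x y = Hom (gr_type P A act \<xi>) x y"
proof -
  have "\<exists>v \<in> carrier A. v \<oplus>\<^bsub>A\<^esub> u = \<zero>\<^bsub>A\<^esub> \<and> u \<oplus>\<^bsub>A\<^esub> v = \<zero>\<^bsub>A\<^esub>" if "u \<in> carrier A" for u
    using that by (intro bexI[of _ "\<ominus>\<^bsub>A\<^esub> u"]) (auto simp: ab.l_neg ab.r_neg)
  then show ?thesis
    by (auto simp: Iso_def Hom_gr_type) (auto simp: gr_type_sel)
qed

theorem gr_category_gr_type: "gr_category (gr_type P A act \<xi>)"
proof -
  let ?S = "gr_type P A act \<xi>"
  note S = Iso_gr_type Hom_gr_type isomorphic_def gr_type_sel
  have "category ?S"
    by unfold_locales (auto simp: S ab.a_assoc split: if_splits)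
  moreover have "monoidal_category_axioms ?S"
  proof (unfold_locales, goal_cases)
    case (4 f x x' f' x'' g y y' g' y'')
    then show ?case
      by (auto simp: S ab.a_ac act_closed act_add split: if_splits)
  next
    case (7 f x x' g y y' h z z')
    then show ?case
      by (auto simp: S ab.a_ac act_closed act_add act_mult \<xi>_closed grp.m_assoc split: if_splits)
  next
    case (12 w x y z)
    then show ?case
      by (simp add: S \<xi>_pentagon grp.m_assoc act_zero \<xi>_closed act_closed)
  qed (auto simp: S grp.m_assoc act_closed act_one act_zero \<xi>_closed \<xi>_normalized
      split: if_splits)
  moreover have "gr_category_axioms ?S"
  proof
    fix f assume "f \<in> Arr ?S"
    then show "f \<in> Iso ?S (Dom ?S f) (Cod ?S f)"
      by (auto simp: S)
  next
    fix x assume "x \<in> Obj ?S"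
    then show "\<exists>y \<in> Obj ?S. isomorphic ?S (TenO ?S x y) (UnitO ?S)
        \<and> isomorphic ?S (TenO ?S y x) (UnitO ?S)"
      by (intro bexI[of _ "inv\<^bsub>P\<^esub> x"]) (auto simp: S)
  qed
  ultimately show ?thesis
    by (simp add: gr_category_def monoidal_category_def)
qed

end

end

theory Submission
  imports Defs
begin

text \<open>
  The only arrows of \<open>(\<Pi>', A', \<xi>')\<close> are automorphisms, so every isomorphism
  \<open>Ft x y : F x \<otimes> F y \<rightarrow> F (x \<otimes> y)\<close> forces its two ends to be equal: this makes \<open>F\<close> multiplicative
  on objects. For the same reason an arrow \<open>(x, u)\<close> goes to some \<open>(F x, f\<^sub>x u)\<close>, and functoriality
  makes each \<open>f\<^sub>x\<close> additive.

  It remains to see that \<open>f\<^sub>x\<close> is independent of \<open>x\<close> and equivariant, and both come from naturality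
  of \<open>Ft\<close>. The second component of a composite is a sum in the commutative group \<open>A'\<close>, so the
  second component of \<open>Ft x y\<close> cancels from the two sides of the naturality square, leaving
  \<open>f\<^sub>x u + F x \<cdot> f\<^sub>y v = f\<^sub>x\<^sub>y (u + x \<cdot> v)\<close>.
  Taking \<open>x = 1\<close> and \<open>v = 0\<close> gives \<open>f\<^sub>1 = f\<^sub>y\<close> (lemma \<open>arrow_part_independent\<close>), and \<open>u = 0\<close>
  gives equivariance (lemma \<open>arrow_part_act\<close>).
\<close>

locale gr_type_functor =
  src: normalized_3cocycle P A act \<xi> +
  tgt: normalized_3cocycle P' A' act' \<xi>' +
  gr_functor "gr_type P A act \<xi>" "gr_type P' A' act' \<xi>'" Fo Fa Ft Fu
  for P :: "('g, 'x) monoid_scheme" and A :: "('a, 'y) ring_scheme"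
    and act :: "'g \<Rightarrow> 'a \<Rightarrow> 'a" and \<xi> :: "'g \<Rightarrow> 'g \<Rightarrow> 'g \<Rightarrow> 'a"
    and P' :: "('h, 'z) monoid_scheme" and A' :: "('b, 'w) ring_scheme"
    and act' :: "'h \<Rightarrow> 'b \<Rightarrow> 'b" and \<xi>' :: "'h \<Rightarrow> 'h \<Rightarrow> 'h \<Rightarrow> 'b"
    and Fo :: "'g \<Rightarrow> 'h" and Fa :: "'g \<times> 'a \<Rightarrow> 'h \<times> 'b"
    and Ft :: "'g \<Rightarrow> 'g \<Rightarrow> 'h \<times> 'b" and Fu :: "'h \<times> 'b"
begin

definition arrow_part :: "'g \<Rightarrow> 'a \<Rightarrow> 'b" where
  "arrow_part x u = snd (Fa (x, u))"

lemma Fo_carrier: "x \<in> carrier P \<Longrightarrow> Fo x \<in> carrier P'"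
  using Fo_closed[of x] by (simp add: gr_type_sel)

text \<open>
  The target is skeletal: the hom-set containing \<open>Ft x y\<close> is empty unless its two objects coincide.
\<close>

lemma Fo_mult:
  assumes "x \<in> carrier P" "y \<in> carrier P"
  shows "Fo (x \<otimes>\<^bsub>P\<^esub> y) = Fo x \<otimes>\<^bsub>P'\<^esub> Fo y"
  using Ft_Iso[of x y] assms
  by (auto simp: gr_type_sel tgt.Iso_gr_type tgt.Hom_gr_type split: if_splits)

lemma Fo_hom: "Fo \<in> hom P P'"
  by (simp add: hom_def Fo_carrier Fo_mult)

lemma Fa_automorphism:
  assumes "x \<in> carrier P" "u \<in> carrier A"
  shows "Fa (x, u) \<in> {Fo x} \<times> carrier A'"
  using Fa_Hom[of "(x, u)" x x] assms
  by (simp add: src.Hom_gr_type tgt.Hom_gr_type Fo_carrier)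

lemma Fa_arrow_part:
  assumes "x \<in> carrier P" "u \<in> carrier A"
  shows "Fa (x, u) = (Fo x, arrow_part x u)"
  using Fa_automorphism[OF assms] by (auto simp: arrow_part_def)

lemma arrow_part_closed:
  assumes "x \<in> carrier P" "u \<in> carrier A"
  shows "arrow_part x u \<in> carrier A'"
  using Fa_automorphism[OF assms] by (auto simp: arrow_part_def)

lemma arrow_part_zero:
  assumes "x \<in> carrier P"
  shows "arrow_part x \<zero>\<^bsub>A\<^esub> = \<zero>\<^bsub>A'\<^esub>"
  using Fa_Ident[of x] assms by (simp add: gr_type_sel arrow_part_def)

lemma arrow_part_add:
  assumes "x \<in> carrier P" "u \<in> carrier A" "v \<in> carrier A"
  shows "arrow_part x (u \<oplus>\<^bsub>A\<^esub> v) = arrow_part x u \<oplus>\<^bsub>A'\<^esub> arrow_part x v"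
  using Fa_Comp[of "(x, v)" x x "(x, u)" x] assms
  by (simp add: src.Hom_gr_type gr_type_sel Fa_arrow_part)

text \<open>
  This is the naturality square of \<open>Ft\<close> at the arrows \<open>(x, u)\<close> and \<open>(y, v)\<close>, after cancelling the
  contribution of \<open>Ft x y\<close>. The twist by \<open>x\<close> and \<open>F x\<close> comes from the tensor product of arrows.
\<close>

lemma arrow_part_tensor:
  assumes x: "x \<in> carrier P" and y: "y \<in> carrier P"
    and u: "u \<in> carrier A" and v: "v \<in> carrier A"
  shows "arrow_part x u \<oplus>\<^bsub>A'\<^esub> act' (Fo x) (arrow_part y v)
    = arrow_part (x \<otimes>\<^bsub>P\<^esub> y) (u \<oplus>\<^bsub>A\<^esub> act x v)"
proof -
  obtain t where t: "Ft x y = (Fo x \<otimes>\<^bsub>P'\<^esub> Fo y, t)" "t \<in> carrier A'"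
    using Ft_Iso[of x y] x y
    by (auto simp: gr_type_sel tgt.Iso_gr_type tgt.Hom_gr_type split: if_splits)
  let ?s = "arrow_part x u \<oplus>\<^bsub>A'\<^esub> act' (Fo x) (arrow_part y v)"
  let ?r = "arrow_part (x \<otimes>\<^bsub>P\<^esub> y) (u \<oplus>\<^bsub>A\<^esub> act x v)"
  have closed: "?s \<in> carrier A'" "?r \<in> carrier A'"
    using assms by (simp_all add: arrow_part_closed tgt.act_closed src.act_closed Fo_carrier)
  have "t \<oplus>\<^bsub>A'\<^esub> ?s = ?r \<oplus>\<^bsub>A'\<^esub> t"
    using Ft_natural[of "(x, u)" x x "(y, v)" y y] assms
    by (simp add: src.Hom_gr_type gr_type_sel Fa_arrow_part t src.act_closed)
  then show ?thesis
    using closed t(2) by (simp add: tgt.ab.a_comm[of ?r t])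
qed

lemma arrow_part_independent:
  assumes "y \<in> carrier P" "u \<in> carrier A"
  shows "arrow_part y u = arrow_part \<one>\<^bsub>P\<^esub> u"
  using arrow_part_tensor[of "\<one>\<^bsub>P\<^esub>" y u "\<zero>\<^bsub>A\<^esub>"] assms
  by (simp add: arrow_part_zero arrow_part_closed src.act_zero tgt.act_zero Fo_carrier)

lemma arrow_part_act:
  assumes "x \<in> carrier P" "a \<in> carrier A"
  shows "arrow_part \<one>\<^bsub>P\<^esub> (act x a) = act' (Fo x) (arrow_part \<one>\<^bsub>P\<^esub> a)"
  using arrow_part_tensor[of x "\<one>\<^bsub>P\<^esub>" "\<zero>\<^bsub>A\<^esub>" a] assms
    arrow_part_independent[of x "act x a"]
  by (simp add: arrow_part_zero arrow_part_closed src.act_closed tgt.act_closed Fo_carrier)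

lemma arrow_part_hom: "arrow_part \<one>\<^bsub>P\<^esub> \<in> hom (add_monoid A) (add_monoid A')"
  by (simp add: hom_def arrow_part_closed arrow_part_add)

end

theorem theorem5:
  fixes P :: "('g, 'x) monoid_scheme" and A :: "('a, 'y) ring_scheme"
    and act :: "'g \<Rightarrow> 'a \<Rightarrow> 'a" and \<xi> :: "'g \<Rightarrow> 'g \<Rightarrow> 'g \<Rightarrow> 'a"
    and P' :: "('h, 'z) monoid_scheme" and A' :: "('b, 'w) ring_scheme"
    and act' :: "'h \<Rightarrow> 'b \<Rightarrow> 'b" and \<xi>' :: "'h \<Rightarrow> 'h \<Rightarrow> 'h \<Rightarrow> 'b"
    and Fo :: "'g \<Rightarrow> 'h" and Fa :: "'g \<times> 'a \<Rightarrow> 'h \<times> 'b"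
    and Ft :: "'g \<Rightarrow> 'g \<Rightarrow> 'h \<times> 'b" and Fu :: "'h \<times> 'b"
  assumes "normalized_3cocycle P A act \<xi>"
    and "normalized_3cocycle P' A' act' \<xi>'"
    and "gr_functor (gr_type P A act \<xi>) (gr_type P' A' act' \<xi>') Fo Fa Ft Fu"
  shows "\<exists>\<phi> f. \<phi> \<in> hom P P' \<and> f \<in> hom (add_monoid A) (add_monoid A')
    \<and> (\<forall>x \<in> carrier P. \<forall>a \<in> carrier A. f (act x a) = act' (\<phi> x) (f a))
    \<and> (\<forall>x \<in> carrier P. Fo x = \<phi> x)
    \<and> (\<forall>x \<in> carrier P. \<forall>u \<in> carrier A. Fa (x, u) = (\<phi> x, f u))"
proof -
  interpret gr_type_functor P A act \<xi> P' A' act' \<xi>' Fo Fa Ft Fu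
    using assms by (simp add: gr_type_functor_def)
  have "Fa (x, u) = (Fo x, arrow_part \<one>\<^bsub>P\<^esub> u)"
    if "x \<in> carrier P" "u \<in> carrier A" for x u
    using Fa_arrow_part[OF that] arrow_part_independent[OF that] by metis
  then show ?thesis
    using Fo_hom arrow_part_hom arrow_part_act
    by (intro exI[of _ Fo] exI[of _ "arrow_part \<one>\<^bsub>P\<^esub>"]) simp
qed

end
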